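(* Let $d \in \{2,3\}$, let $W \colon \mathbb{R}^{d \times d} \to \mathbb{R}$ be isotropic (and finite-valued), and let $\Phi \colon \mathbb{R}^{d} \to \mathbb{R}$ be given by $\Phi(\nu) = W(\operatorname{diag}(\nu))$ for $\nu\in\mathbb{R}^d$. Then the following statements are equivalent: (i) $W$ is polyconvex; (ii) there exists a convex function $g \colon \mathbb{R}^{k_d} \to \mathbb{R}$ such that $W(\operatorname{diag}(\nu)) = g(m(\nu))$ for all $\nu \in \mathbb{R}^{d}$; (iii) $\Phi$ is polyconvex (in the sense of functions on $\mathbb{R}^d$).
   Context: $\mathbb{R}_\infty := \mathbb{R}\cup\{\infty\}$. $\mathrm{SO}(d)$ is the special orthogonal group. $\operatorname{diag}(\nu)$ is the diagonal $d\times d$ matrix with diagonal entries $\nu_1,\dots,\nu_d$. Isotropic: $W$ is isotropic if $W(F) = W(R_1 F R_2)$ for all $F \in \mathbb{R}^{d\times d}$ and $R_1,R_2\in \mathrm{SO}(d)$. Polyconvexity on matrices: let $\mathcal{M}(F)\in\mathbb{R}^{K_d}$, $K_d=\sum_{i=1}^d\binom{d}{i}^2$, be the vector of all minors of $F\in\mathbb{R}^{d\times d}$; that is, $\mathcal{M}(F)=(F,\det F)\in\mathbb{R}^5$ for $d=2$ and $\mathcal{M}(F)=(F,\operatorname{adj}(F)^\top,\det F)\in\mathbb{R}^{19}$ for $d=3$, where $\operatorname{adj}(F)$ is the adjugate matrix. A function $W \colon \mathbb{R}^{d \times d} \to \mathbb{R}_\infty$ is polyconvex if there is a convex function $G\colon\mathbb{R}^{K_d}\to\mathbb{R}_\infty$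 with $W(F)=G(\mathcal{M}(F))$ for all $F\in\mathbb{R}^{d\times d}$. Polyconvexity on vectors: $k_d=2^d-1$, and $m\colon\mathbb{R}^d\to\mathbb{R}^{k_d}$ is $m(\nu)=(\nu_1,\nu_2,\nu_1\nu_2)$ for $d=2$ and $m(\nu)=(\nu_1,\nu_2,\nu_3,\nu_2\nu_3,\nu_1\nu_3,\nu_1\nu_2,\nu_1\nu_2\nu_3)$ for $d=3$. A function $\Phi\colon\mathbb{R}^d\to\mathbb{R}_\infty$ is polyconvex if there is a convex function $g\colon\mathbb{R}^{k_d}\to\mathbb{R}_\infty$ with $\Phi(\nu)=g(m(\nu))$ for all $\nu\in\mathbb{R}^d$. *)

theory Defs
  imports "HOL-Analysis.Analysis"
begin

definition diag :: "real^'n \<Rightarrow> real^'n^'n" where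
  "diag \<nu> = (\<chi> i j. if i = j then \<nu> $ i else 0)"

definition isotropic :: "(real^'n^'n \<Rightarrow> 'b) \<Rightarrow> bool" where
  "isotropic W \<longleftrightarrow>
     (\<forall>F R1 R2. rotation_matrix R1 \<and> rotation_matrix R2 \<longrightarrow> W F = W (R1 ** F ** R2))"

text \<open>
  Replacing row \<open>i\<close> and column \<open>j\<close> by unit vectors gives the signed \<open>(i, j)\<close> cofactor
  without reference to an ordering of the index type.
\<close>

definition cofactor :: "real^'n^'n \<Rightarrow> real^'n^'n" where
  "cofactor A = (\<chi> i j. det (\<chi> k l. if k = i \<and> l = j then 1
                                    else if k = i \<or> l = j then 0 else A $ k $ l))"

definition adjugate :: "real^'n^'n \<Rightarrow> real^'n^'n" where
  "adjugate A = transpose (cofactor A)"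

lemma cofactor_3:
  fixes A :: "real^3^3"
  shows "cofactor A = vector
    [vector [A$2$2 * A$3$3 - A$2$3 * A$3$2, A$2$3 * A$3$1 - A$2$1 * A$3$3, A$2$1 * A$3$2 - A$2$2 * A$3$1],
     vector [A$1$3 * A$3$2 - A$1$2 * A$3$3, A$1$1 * A$3$3 - A$1$3 * A$3$1, A$1$2 * A$3$1 - A$1$1 * A$3$2],
     vector [A$1$2 * A$2$3 - A$1$3 * A$2$2, A$1$3 * A$2$1 - A$1$1 * A$2$3, A$1$1 * A$2$2 - A$1$2 * A$2$1]]"
  by (simp add: vec_eq_iff forall_3 cofactor_def det_3)

lemma adjugate_mult_3:
  fixes A :: "real^3^3"
  shows "A ** adjugate A = mat (det A)" and "adjugate A ** A = mat (det A)"
  by (simp_all add: vec_eq_iff forall_3 adjugate_def cofactor_3 transpose_def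
      matrix_matrix_mult_def sum_3 mat_def det_3 algebra_simps)

text \<open>
  A function into \<open>\<real> \<union> {\<infinity>}\<close> is an \<open>ereal\<close>-valued function that avoids \<open>-\<infinity>\<close>.
  The endpoints \<open>u = 0\<close> and \<open>v = 0\<close>, where the inequality is trivial, are left out.
\<close>

definition convex_ext :: "('a::real_vector \<Rightarrow> ereal) \<Rightarrow> bool" where
  "convex_ext G \<longleftrightarrow>
     (\<forall>x. G x \<noteq> -\<infinity>) \<and>
     (\<forall>x y u v. 0 < u \<and> 0 < v \<and> u + v = 1 \<longrightarrow>
        G (u *\<^sub>R x + v *\<^sub>R y) \<le> ereal u * G x + ereal v * G y)"

text \<open>
  The spaces of dimension 5 and 19 (minors) and 3 and 7 (elementary products) are represented
  as product spaces, grouped by the order of the minors.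
\<close>

definition minors2 :: "real^2^2 \<Rightarrow> (real^2^2) \<times> real" where
  "minors2 F = (F, det F)"

definition minors3 :: "real^3^3 \<Rightarrow> (real^3^3) \<times> (real^3^3) \<times> real" where
  "minors3 F = (F, transpose (adjugate F), det F)"

definition m2 :: "real^2 \<Rightarrow> (real^2) \<times> real" where
  "m2 \<nu> = (\<nu>, \<nu>$1 * \<nu>$2)"

definition m3 :: "real^3 \<Rightarrow> (real^3) \<times> (real^3) \<times> real" where
  "m3 \<nu> = (\<nu>, vector [\<nu>$2 * \<nu>$3, \<nu>$1 * \<nu>$3, \<nu>$1 * \<nu>$2], \<nu>$1 * \<nu>$2 * \<nu>$3)"

definition polyconvex_mat2 :: "(real^2^2 \<Rightarrow> ereal) \<Rightarrow> bool" where
  "polyconvex_mat2 W \<longleftrightarrow> (\<exists>G. convex_ext G \<and> (\<forall>F. W F = G (minors2 F)))"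

definition polyconvex_mat3 :: "(real^3^3 \<Rightarrow> ereal) \<Rightarrow> bool" where
  "polyconvex_mat3 W \<longleftrightarrow> (\<exists>G. convex_ext G \<and> (\<forall>F. W F = G (minors3 F)))"

definition polyconvex_vec2 :: "(real^2 \<Rightarrow> ereal) \<Rightarrow> bool" where
  "polyconvex_vec2 \<Phi> \<longleftrightarrow> (\<exists>g. convex_ext g \<and> (\<forall>\<nu>. \<Phi> \<nu> = g (m2 \<nu>)))"

definition polyconvex_vec3 :: "(real^3 \<Rightarrow> ereal) \<Rightarrow> bool" where
  "polyconvex_vec3 \<Phi> \<longleftrightarrow> (\<exists>g. convex_ext g \<and> (\<forall>\<nu>. \<Phi> \<nu> = g (m3 \<nu>)))"

end

theory Submission
  imports Defs
begin

text \<open>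
  A convex \<open>g\<close> with \<open>W (diag \<nu>) = g (m \<nu>)\<close> is lifted to the space of minors by
  \<open>G X = (SUP (R, S). g (diagonal part of R X S))\<close>, where rotations act on minors of orders 1 and 2
  simultaneously and fix the determinant. This is convex as a supremum of convex functions. Writing
  \<open>F = R diag \<nu> S\<close> with rotations gives \<open>G (minors F) \<ge> W F\<close>. For the converse, the map
  \<open>x \<mapsto> diagonal part of R (diag x) S\<close> is given by the Hadamard product of \<open>R\<close> and \<open>transpose S\<close>, and this is a
  convex combination of permutations with an even number of sign changes, which leave \<open>W (diag \<nu>)\<close>
  invariant and commute with \<open>m\<close>. For \<open>d = 3\<close> these form the symmetry group \<open>S\<^sub>4\<close> of a
  regular tetrahedron, and the claim becomes Birkhoff's theorem for \<open>4 \<times> 4\<close> matrices together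
  with \<open>trace Q \<ge> -1\<close> for rotations \<open>Q\<close>.

  An extended-valued \<open>g\<close> that is finite on the range of \<open>m\<close> is finite everywhere, because the convex
  hull of this range is the whole space.
\<close>

section \<open>Doubly stochastic matrices\<close>

text \<open>
  Rado's argument: if deleting either of two elements of \<open>N a\<close> destroys Hall's condition, then
  submodularity of the cardinality of the neighbourhood, applied to the two violating sets, is contradicted.
\<close>

theorem hall_marriage:
  fixes N :: "'a \<Rightarrow> 'b set"
  assumes "finite A" and "\<And>a. a \<in> A \<Longrightarrow> finite (N a)"
    and "\<And>X. X \<subseteq> A \<Longrightarrow> card X \<le> card (\<Union>(N ` X))"
  shows "\<exists>f. inj_on f A \<and> (\<forall>a\<in>A. f a \<in> N a)"
  using assms(2,3)
proof (induction "\<Sum>a\<in>A. card (N a)" arbitrary: N rule: less_induct)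
  case (less N)
  have fin_Un: "finite (\<Union>(N ` X))" if "X \<subseteq> A" for X
    using that less.prems(1) \<open>finite A\<close> by (meson finite_UN finite_subset subsetD)
  show ?case
  proof (cases "\<exists>a\<in>A. \<exists>x y. x \<in> N a \<and> y \<in> N a \<and> x \<noteq> y")
    case False
    have "N a \<noteq> {}" if "a \<in> A" for a
      using less.prems(2)[of "{a}"] that by auto
    then have "(SOME x. x \<in> N a) \<in> N a" if "a \<in> A" for a
      using that by (simp add: some_in_eq)
    then have f: "N a = {SOME x. x \<in> N a}" if "a \<in> A" for a
      using False that by blast
    have "inj_on (\<lambda>a. SOME x. x \<in> N a) A"
    proof (rule inj_onI, rule ccontr)
      fix a b assume ab: "a \<in> A" "b \<in> A" "(SOME x. x \<in> N a) = (SOME x. x \<in> N b)" "a \<noteq> b"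
      then have "\<Union>(N ` {a, b}) = {SOME x. x \<in> N a}"
        using f[of a] f[of b] by auto
      then show False
        using less.prems(2)[of "{a, b}"] ab by simp
    qed
    then show ?thesis
      using f by blast
  next
    case True
    then obtain a x y where a: "a \<in> A" and x: "x \<in> N a" and y: "y \<in> N a" and "x \<noteq> y"
      by blast
    have reduce: ?thesis
      if z: "z \<in> N a" and hall: "\<And>X. X \<subseteq> A \<Longrightarrow> card X \<le> card (\<Union>((N(a := N a - {z})) ` X))" for z
    proof -
      let ?N = "N(a := N a - {z})"
      have "(\<Sum>b\<in>A. card (?N b)) < (\<Sum>b\<in>A. card (N b))"
      proof (rule sum_strict_mono_ex1[OF \<open>finite A\<close>])
        show "\<forall>b\<in>A. card (?N b) \<le> card (N b)"
          using less.prems(1) by (auto intro!: card_mono)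
        show "\<exists>b\<in>A. card (?N b) < card (N b)"
          using a z less.prems(1) by (intro bexI[of _ a]) (simp_all add: card_Diff1_less del: card_Diff_insert)
      qed
      then have "\<exists>f. inj_on f A \<and> (\<forall>b\<in>A. f b \<in> ?N b)"
        proof (rule less.hyps)
        show "finite (?N b)" if "b \<in> A" for b
          using less.prems(1)[OF that] by auto
      qed (rule hall)
      then obtain f where f: "inj_on f A" "\<And>b. b \<in> A \<Longrightarrow> f b \<in> ?N b"
        by blast
      have "f b \<in> N b" if "b \<in> A" for b
        using f(2)[OF that] by (simp split: if_splits)
      then show ?thesis
        using f(1) by blast
    qed
    \<comment> \<open>A set violating the reduced condition must contain \<open>a\<close>. Dropping
      \<open>a\<close> lowers its cardinality by one, which turns the strict inequality into
      \<open>\<le>\<close>.\<close>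
    have violator: "\<exists>X. X \<subseteq> A \<and> a \<notin> X \<and> card (\<Union>(N ` X) \<union> (N a - {z})) \<le> card X"
      if not_hall: "\<not> (\<forall>X. X \<subseteq> A \<longrightarrow> card X \<le> card (\<Union>((N(a := N a - {z})) ` X)))" for z
    proof -
      obtain X where X: "X \<subseteq> A" "card (\<Union>((N(a := N a - {z})) ` X)) < card X"
        using not_hall by (auto simp: not_le)
      have "a \<in> X"
      proof (rule ccontr)
        assume "a \<notin> X"
        then have "\<Union>((N(a := N a - {z})) ` X) = \<Union>(N ` X)"
          by auto
        then show False
          using X less.prems(2)[of X] by simp
      qed
      then have "\<Union>((N(a := N a - {z})) ` X) = \<Union>(N ` (X - {a})) \<union> (N a - {z})"
        by (auto split: if_splits)
      moreover have "card X = Suc (card (X - {a}))"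
        using \<open>a \<in> X\<close> X \<open>finite A\<close> by (metis card.remove finite_subset)
      ultimately show ?thesis
        using X by (intro exI[of _ "X - {a}"]) auto
    qed
    show ?thesis
    proof (rule ccontr)
      assume no: "\<not> ?thesis"
      obtain X where X: "X \<subseteq> A" "a \<notin> X" "card (\<Union>(N ` X) \<union> (N a - {x})) \<le> card X"
        using reduce[OF x] violator[of x] no by blast
      obtain Y where Y: "Y \<subseteq> A" "a \<notin> Y" "card (\<Union>(N ` Y) \<union> (N a - {y})) \<le> card Y"
        using reduce[OF y] violator[of y] no by blast
      let ?U = "\<Union>(N ` X) \<union> (N a - {x})" and ?V = "\<Union>(N ` Y) \<union> (N a - {y})"
      have fin: "finite ?U" "finite ?V" "finite X" "finite Y"
        using fin_Un X(1) Y(1) less.prems(1)[OF a] \<open>finite A\<close> by (auto intro: finite_subset)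
      \<comment> \<open>Since \<open>x \<noteq> y\<close>, the sets \<open>N a - {x}\<close> and
        \<open>N a - {y}\<close> together exhaust \<open>N a\<close>. Adding \<open>a\<close> to the
        union gains the 1 that contradicts the two upper bounds on \<open>?U\<close> and
        \<open>?V\<close>.\<close>
      have "?U \<union> ?V = \<Union>(N ` insert a (X \<union> Y))"
        using \<open>x \<noteq> y\<close> by auto
      then have "Suc (card (X \<union> Y)) \<le> card (?U \<union> ?V)"
        using less.prems(2)[of "insert a (X \<union> Y)"] a X Y fin by simp
      moreover have "card (X \<inter> Y) \<le> card (?U \<inter> ?V)"
      proof -
        have "card (X \<inter> Y) \<le> card (\<Union>(N ` (X \<inter> Y)))"
          using less.prems(2)[of "X \<inter> Y"] X by blast
        also have "\<dots> \<le> card (?U \<inter> ?V)"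
          using fin by (intro card_mono) auto
        finally show ?thesis .
      qed
      ultimately show False
        using card_Un_Int[OF fin(1,2)] card_Un_Int[OF fin(3,4)] X(3) Y(3) by linarith
    qed
  qed
qed

text \<open>Hall's condition for the support is a mass count: the rows in \<open>X\<close> carry
  mass \<open>s * card X\<close>, all of it in the neighbouring columns, whose total mass is
  \<open>s\<close> times their number.\<close>

lemma doubly_stochastic_support_permutation:
  fixes B :: "'n::finite \<Rightarrow> 'n \<Rightarrow> real"
  assumes nonneg: "\<And>k l. 0 \<le> B k l" and "s > 0"
    and rows: "\<And>k. (\<Sum>l\<in>UNIV. B k l) = s" and cols: "\<And>l. (\<Sum>k\<in>UNIV. B k l) = s"
  obtains p where "p permutes UNIV" "\<And>k. B k (p k) > 0"
proof -
  define N where "N k = {l. B k l > 0}" for k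
  have "card X \<le> card (\<Union>(N ` X))" for X
  proof -
    have "s * card X = (\<Sum>k\<in>X. \<Sum>l\<in>UNIV. B k l)"
      by (simp add: rows)
    also have "\<dots> = (\<Sum>k\<in>X. \<Sum>l\<in>\<Union>(N ` X). B k l)"
    proof (intro sum.cong[OF refl] sum.mono_neutral_right ballI)
      fix k l assume "k \<in> X" "l \<in> UNIV - \<Union>(N ` X)"
      then have "\<not> B k l > 0"
        by (auto simp: N_def)
      then show "B k l = 0"
        using nonneg[of k l] by simp
    qed auto
    also have "\<dots> \<le> (\<Sum>k\<in>UNIV. \<Sum>l\<in>\<Union>(N ` X). B k l)"
      by (intro sum_mono2) (auto intro: sum_nonneg nonneg)
    also have "\<dots> = (\<Sum>l\<in>\<Union>(N ` X). \<Sum>k\<in>UNIV. B k l)"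
      by (rule sum.swap)
    also have "\<dots> = s * card (\<Union>(N ` X))"
      by (simp add: cols)
    finally show ?thesis
      using \<open>s > 0\<close> by simp
  qed
  then obtain f where "inj_on f UNIV" "\<forall>k\<in>UNIV. f k \<in> N k"
    using hall_marriage[of UNIV N] by auto
  moreover from this have "f permutes UNIV"
    by (intro bij_imp_permutes) (auto simp: bij_betw_def finite_UNIV_inj_surj)
  ultimately show thesis
    using that by (auto simp: N_def)
qed

text \<open>Subtracting the least entry \<open>e\<close> along a permutation inside the support
  leaves row and column sums \<open>s - e\<close> and fewer positive entries. A general sum
  \<open>s\<close> lets the remainder meet the induction hypothesis without rescaling.\<close>

theorem birkhoff_von_neumann:
  fixes B :: "'n::finite \<Rightarrow> 'n \<Rightarrow> real"
  assumes "\<And>k l. 0 \<le> B k l" and "s \<ge> 0"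
    and "\<And>k. (\<Sum>l\<in>UNIV. B k l) = s" and "\<And>l. (\<Sum>k\<in>UNIV. B k l) = s"
  shows "\<exists>w. (\<forall>p. 0 \<le> w p) \<and> (\<Sum>p | p permutes UNIV. w p) = s \<and>
    (\<forall>k l. B k l = (\<Sum>p | p permutes UNIV. if p k = l then w p else 0))"
  using assms
proof (induction "card {(k, l). B k l > 0}" arbitrary: B s rule: less_induct)
  case (less B s)
  show ?case
  proof (cases "s = 0")
    case True
    have "B k l = 0" for k l
      using less.prems(3)[of k] True sum_nonneg_eq_0_iff[of UNIV "B k"] less.prems(1) by simp
    then show ?thesis
      using True by (intro exI[of _ "\<lambda>_. 0"]) auto
  next
    case False
    then have "s > 0"
      using less.prems(2) by simp
    then obtain q where q: "q permutes UNIV" and pos: "\<And>k. B k (q k) > 0"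
      using doubly_stochastic_support_permutation[of B s] less.prems by metis
    define e where "e = Min (range (\<lambda>k. B k (q k)))"
    have e_le: "e \<le> B k (q k)" for k
      by (auto simp: e_def)
    have "e \<in> range (\<lambda>k. B k (q k))"
      unfolding e_def by (rule Min_in) auto
    then obtain k0 where k0: "e = B k0 (q k0)"
      by auto
    define B' where "B' k l = B k l - (if q k = l then e else 0)" for k l
    have "e > 0"
      using pos k0 by simp
    have nonneg': "0 \<le> B' k l" for k l
      using e_le less.prems(1) by (auto simp: B'_def)
    have rows': "(\<Sum>l\<in>UNIV. B' k l) = s - e" for k
      by (simp add: B'_def sum_subtractf less.prems)
    have "(\<Sum>k\<in>UNIV. if q k = l then e else 0) = e" for l
    proof -
      have "(\<Sum>k\<in>UNIV. if q k = l then e else 0) = (\<Sum>k\<in>UNIV. if k = l then e else 0)"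
        by (rule sum.permute[OF q, unfolded comp_def, symmetric])
      then show ?thesis
        by simp
    qed
    then have cols': "(\<Sum>k\<in>UNIV. B' k l) = s - e" for l
      by (simp add: B'_def sum_subtractf less.prems)
    \<comment> \<open>The entry in row \<open>k0\<close>, where the minimum is attained, drops to
      zero.\<close>
    have "{(k, l). B' k l > 0} \<subset> {(k, l). B k l > 0}"
    proof
      show "{(k, l). B' k l > 0} \<subseteq> {(k, l). B k l > 0}"
        using \<open>e > 0\<close> by (auto simp: B'_def split: if_splits)
      have "(k0, q k0) \<notin> {(k, l). B' k l > 0}" "(k0, q k0) \<in> {(k, l). B k l > 0}"
        using pos by (simp_all add: B'_def k0)
      then show "{(k, l). B' k l > 0} \<noteq> {(k, l). B k l > 0}"
        by blast
    qed
    then have "card {(k, l). B' k l > 0} < card {(k, l). B k l > 0}"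
      by (intro psubset_card_mono) auto
    moreover have "s - e \<ge> 0"
      using rows'[of k0] nonneg' by (metis sum_nonneg)
    ultimately obtain w where w: "\<And>p. 0 \<le> w p" "(\<Sum>p | p permutes UNIV. w p) = s - e"
      "\<And>k l. B' k l = (\<Sum>p | p permutes UNIV. if p k = l then w p else 0)"
      using less.hyps[of B' "s - e"] nonneg' rows' cols' by blast
    let ?w = "\<lambda>p. w p + (if p = q then e else 0)"
    have fin: "finite {p::'n \<Rightarrow> 'n. p permutes UNIV}"
      by (simp add: finite_permutations)
    show ?thesis
    proof (intro exI[of _ ?w] conjI allI)
      show "0 \<le> ?w p" for p
        using w(1)[of p] \<open>e > 0\<close> by simp
      show "(\<Sum>p | p permutes UNIV. ?w p) = s"
        using fin q by (simp add: sum.distrib w(2))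
      fix k l
      have "(\<Sum>p | p permutes UNIV. if p k = l then ?w p else 0) =
          (\<Sum>p | p permutes UNIV. (if p k = l then w p else 0) + (if p = q then if q k = l then e else 0 else 0))"
        by (intro sum.cong) auto
      also have "\<dots> = B' k l + (if q k = l then e else 0)"
        using fin q by (simp add: sum.distrib w(3))
      finally show "B k l = (\<Sum>p | p permutes UNIV. if p k = l then ?w p else 0)"
        by (simp add: B'_def)
    qed
  qed
qed

section \<open>Signed singular values\<close>

lemma rotation_matrix_mult:
  "rotation_matrix A \<Longrightarrow> rotation_matrix B \<Longrightarrow> rotation_matrix (A ** B)"
  for A B :: "real^'n^'n"
  by (simp add: rotation_matrix_def orthogonal_matrix_mul det_mul)

lemma rotation_matrix_transpose: "rotation_matrix A \<Longrightarrow> rotation_matrix (transpose A)"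
  for A :: "real^'n^'n"
  by (simp add: rotation_matrix_def)

lemma rotation_matrix_mat_1: "rotation_matrix (mat 1 :: real^'n^'n)"
  by (simp add: rotation_matrix_def orthogonal_matrix_id)

lemma rotation_matrix_inverse:
  assumes "rotation_matrix A"
  shows "A ** transpose A = mat 1" "transpose A ** A = mat 1"
  using assms by (simp_all add: rotation_matrix_def orthogonal_matrix_def)

section \<open>Plane rotations and criticality\<close>

definition plane_rotation :: "'n \<Rightarrow> 'n \<Rightarrow> real \<Rightarrow> real^'n^'n" where
  "plane_rotation i j \<theta> = (\<chi> k l.
     if k = i then (if l = i then cos \<theta> else if l = j then - sin \<theta> else 0)
     else if k = j then (if l = i then sin \<theta> else if l = j then cos \<theta> else 0)
     else if k = l then 1 else 0)"

lemma sum_two_deltas: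
  fixes a b :: "'a::comm_monoid_add"
  assumes "i \<noteq> j"
  shows "(\<Sum>m\<in>(UNIV :: 'n::finite set). if m = i then a else if m = j then b else 0) = a + b"
proof -
  have "(\<Sum>m\<in>UNIV. if m = i then a else if m = j then b else 0) =
      (\<Sum>m\<in>UNIV. (if m = i then a else 0) + (if m = j then b else 0))"
    using assms by (intro sum.cong) auto
  then show ?thesis
    by (simp add: sum.distrib)
qed

lemma plane_rotation_mult_nth:
  fixes A :: "real^'n^'n"
  assumes "i \<noteq> j"
  shows "(plane_rotation i j \<theta> ** A) $ k $ l =
    (if k = i then cos \<theta> * A $ i $ l - sin \<theta> * A $ j $ l
     else if k = j then sin \<theta> * A $ i $ l + cos \<theta> * A $ j $ l else A $ k $ l)"
  using assms by (simp add: plane_rotation_def matrix_matrix_mult_def sum_two_deltas if_distrib[of "\<lambda>x. x * _"] cong: if_cong)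

lemma transpose_plane_rotation:
  assumes "i \<noteq> j"
  shows "transpose (plane_rotation i j \<theta>) = plane_rotation i j (- \<theta>)"
  using assms by (auto simp: plane_rotation_def transpose_def vec_eq_iff)

lemma plane_rotation_add:
  assumes "i \<noteq> j"
  shows "plane_rotation i j \<theta> ** plane_rotation i j \<phi> = plane_rotation i j (\<theta> + \<phi>)"
  using assms
  by (auto simp: vec_eq_iff plane_rotation_mult_nth cos_add sin_add) (auto simp: plane_rotation_def cos_add sin_add)

lemma plane_rotation_0: "i \<noteq> j \<Longrightarrow> plane_rotation i j 0 = mat 1"
  by (auto simp: vec_eq_iff plane_rotation_def mat_def)

lemma rotation_matrix_plane_rotation:
  fixes i j :: "'n::finite"
  assumes "i \<noteq> j"
  shows "rotation_matrix (plane_rotation i j \<theta>)"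
proof -
  have orth: "orthogonal_matrix (plane_rotation i j \<phi>)" for \<phi>
    using assms by (simp add: orthogonal_matrix transpose_plane_rotation plane_rotation_add plane_rotation_0)
  \<comment> \<open>Halving the angle excludes determinant \<open>-1\<close>.\<close>
  have "det (plane_rotation i j \<theta>) = (det (plane_rotation i j (\<theta> / 2)))\<^sup>2"
    using plane_rotation_add[OF assms, of "\<theta> / 2" "\<theta> / 2"] by (metis det_mul field_sum_of_halves power2_eq_square)
  moreover have "\<dots> = 1"
    using det_orthogonal_matrix[OF orth] by (auto simp: power2_eq_1_iff)
  ultimately show ?thesis
    using orth by (simp add: rotation_matrix_def)
qed

text \<open>Rows of unit length give boundedness; the defining conditions are polynomial equations,
  hence closed.\<close>

lemma compact_rotation_matrices: "compact {R :: real^'n^'n. rotation_matrix R}"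
  unfolding compact_eq_bounded_closed
proof
  have "norm R \<le> real CARD('n)" if "rotation_matrix R" for R :: "real^'n^'n"
  proof -
    have "norm (R $ i) = 1" for i
      using that by (simp add: rotation_matrix_def orthogonal_matrix_orthonormal_rows row_def vec_lambda_eta)
    then have "(\<Sum>i\<in>UNIV. norm (R $ i)) = real CARD('n)"
      by simp
    then show ?thesis
      using L2_set_le_sum[of UNIV "\<lambda>i. norm (R $ i)"] by (simp add: norm_vec_def)
  qed
  then show "bounded {R :: real^'n^'n. rotation_matrix R}"
    by (auto simp: bounded_iff)
  have "closed {R :: real^'n^'n. transpose R ** R = mat 1 \<and> det R = 1}"
    unfolding matrix_matrix_mult_def transpose_def det_def
    by (intro closed_Collect_conj closed_Collect_eq continuous_intros)
  then show "closed {R :: real^'n^'n. rotation_matrix R}"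
    by (simp add: rotation_matrix_def orthogonal_matrix)
qed

text \<open>In polar form the expression attains both \<open>\<rho>\<close> and
  \<open>- \<rho>\<close>, so \<open>q\<^sup>2\<close> is at least
  \<open>\<rho>\<^sup>2 = q\<^sup>2 + r\<^sup>2\<close>. Both values are used because the sign of
  \<open>\<rho>\<close> is unknown.\<close>

lemma cos_sin_maximal_at_0:
  fixes q r :: real
  assumes "\<And>\<theta>. q * cos \<theta> + r * sin \<theta> \<le> q"
  shows "r = 0"
proof -
  obtain \<rho> \<phi> where \<rho>: "q = \<rho> * cos \<phi>" "r = \<rho> * sin \<phi>"
    using polar_Ex by blast
  have *: "\<rho> * cos \<phi> * cos \<phi> + \<rho> * sin \<phi> * sin \<phi> = \<rho>"
    using sin_cos_squared_add[of \<phi>] by algebra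
  have "\<rho> \<le> q" "- \<rho> \<le> q"
    using assms[of \<phi>] assms[of "\<phi> + pi"] * by (simp_all add: \<rho> cos_add sin_add)
  then have "\<rho>\<^sup>2 \<le> q\<^sup>2"
    by (simp add: abs_le_square_iff[symmetric])
  moreover have "\<rho>\<^sup>2 = q\<^sup>2 + r\<^sup>2"
    using sin_cos_squared_add[of \<phi>] \<rho> by algebra
  ultimately show ?thesis
    by simp
qed


text \<open>As a function of the angle, the weighted trace is
  \<open>?q * cos \<theta> + ?r * sin \<theta>\<close> up to a constant; a maximum at angle 0 forces
  \<open>?r = 0\<close>.\<close>

lemma plane_rotation_critical:
  fixes A :: "real^'n^'n" and c :: "'n \<Rightarrow> real"
  assumes "i \<noteq> j"
    and "\<And>\<theta>. (\<Sum>k\<in>UNIV. c k * (plane_rotation i j \<theta> ** A) $ k $ k) \<le> (\<Sum>k\<in>UNIV. c k * A $ k $ k)"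
  shows "c j * A $ i $ j = c i * A $ j $ i"
proof -
  let ?q = "c i * A $ i $ i + c j * A $ j $ j" and ?r = "c j * A $ i $ j - c i * A $ j $ i"
  have "?q * cos \<theta> + ?r * sin \<theta> \<le> ?q" for \<theta>
  proof -
    have "(\<Sum>k\<in>UNIV. c k * (plane_rotation i j \<theta> ** A) $ k $ k) - (\<Sum>k\<in>UNIV. c k * A $ k $ k) =
        (\<Sum>k\<in>UNIV. c k * (plane_rotation i j \<theta> ** A) $ k $ k - c k * A $ k $ k)"
      by (simp add: sum_subtractf)
    also have "\<dots> = (\<Sum>k\<in>UNIV.
          if k = i then c i * (cos \<theta> * A $ i $ i - sin \<theta> * A $ j $ i) - c i * A $ i $ i
          else if k = j then c j * (sin \<theta> * A $ i $ j + cos \<theta> * A $ j $ j) - c j * A $ j $ j else 0)"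
      by (intro sum.cong) (auto simp: plane_rotation_mult_nth[OF assms(1)])
    also have "\<dots> = ?q * cos \<theta> + ?r * sin \<theta> - ?q"
      by (subst sum_two_deltas[OF assms(1)]) (simp add: algebra_simps)
    finally show ?thesis
      using assms(2)[of \<theta>] by simp
  qed
  then show ?thesis
    using cos_sin_maximal_at_0 by (metis eq_iff_diff_eq_0)
qed

text \<open>
  Maximise \<open>\<Sum>i. c i * (R F S) $ i $ i\<close> over all rotations \<open>R\<close>, \<open>S\<close>, where the weights \<open>c\<close> are positive
  and distinct. Criticality under left and right plane rotations makes both \<open>diag c ** A\<close> and
  \<open>A ** diag c\<close> symmetric for the maximal \<open>A = R F S\<close>, which forces \<open>A\<close> to be diagonal.
\<close>

theorem signed_singular_value_decomposition:
  fixes F :: "real^'n^'n"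
  obtains R S \<nu> where "rotation_matrix R" "rotation_matrix S" "F = R ** diag \<nu> ** S"
proof -
  obtain f :: "'n \<Rightarrow> nat" where f: "inj f"
    using finite_imp_inj_to_nat_seg[of "UNIV :: 'n set"] by auto
  define c where "c i = real (f i) + 1" for i
  have c_pos: "c i > 0" for i
    by (simp add: c_def)
  have c_inj: "c i = c j \<Longrightarrow> i = j" for i j
    using f by (simp add: c_def inj_eq)
  let ?SO = "{R :: real^'n^'n. rotation_matrix R}"
  have "compact (?SO \<times> ?SO)"
    by (intro compact_Times compact_rotation_matrices)
  moreover have "?SO \<times> ?SO \<noteq> {}"
    using rotation_matrix_mat_1 by blast
  moreover have "continuous_on (?SO \<times> ?SO) (\<lambda>p. \<Sum>k\<in>UNIV. c k * (fst p ** F ** snd p) $ k $ k)"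
    unfolding matrix_matrix_mult_def by (intro continuous_intros)
  ultimately obtain p where "p \<in> ?SO \<times> ?SO"
    and p: "\<And>p'. p' \<in> ?SO \<times> ?SO \<Longrightarrow> (\<Sum>k\<in>UNIV. c k * (fst p' ** F ** snd p') $ k $ k)
       \<le> (\<Sum>k\<in>UNIV. c k * (fst p ** F ** snd p) $ k $ k)"
    using continuous_attains_sup by (smt (verit, del_insts))
  then obtain R S where R: "rotation_matrix R" and S: "rotation_matrix S" and RS: "p = (R, S)"
    by auto
  define A where "A = R ** F ** S"
  have max: "(\<Sum>k\<in>UNIV. c k * (R' ** F ** S') $ k $ k) \<le> (\<Sum>k\<in>UNIV. c k * A $ k $ k)"
    if "rotation_matrix R'" "rotation_matrix S'" for R' S'
    using p[of "(R', S')"] that by (simp add: RS A_def)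
  have offdiag: "A $ i $ j = 0" if "i \<noteq> j" for i j
  proof -
    have "c j * A $ i $ j = c i * A $ j $ i"
    proof (rule plane_rotation_critical[OF that])
      fix \<theta>
      show "(\<Sum>k\<in>UNIV. c k * (plane_rotation i j \<theta> ** A) $ k $ k) \<le> (\<Sum>k\<in>UNIV. c k * A $ k $ k)"
        using max[of "plane_rotation i j \<theta> ** R" S]
        by (simp add: A_def matrix_mul_assoc rotation_matrix_mult rotation_matrix_plane_rotation R S that)
    qed
    moreover have "c j * transpose A $ i $ j = c i * transpose A $ j $ i"
    proof (rule plane_rotation_critical[OF that])
      fix \<theta>
      \<comment> \<open>Rotating \<open>A\<close> from the right is rotating
        \<open>transpose A\<close> from the left, and transposition keeps the diagonal, so the same
        criticality lemma covers variations of \<open>S\<close>.\<close>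
      have "plane_rotation i j \<theta> ** transpose A = transpose (A ** plane_rotation i j (- \<theta>))"
        by (simp add: matrix_transpose_mul transpose_plane_rotation that)
      then have "(plane_rotation i j \<theta> ** transpose A) $ k $ k = (A ** plane_rotation i j (- \<theta>)) $ k $ k" for k
        by (simp add: transpose_def)
      then show "(\<Sum>k\<in>UNIV. c k * (plane_rotation i j \<theta> ** transpose A) $ k $ k)
          \<le> (\<Sum>k\<in>UNIV. c k * transpose A $ k $ k)"
        using max[of R "S ** plane_rotation i j (- \<theta>)"]
        by (simp add: A_def matrix_mul_assoc rotation_matrix_mult rotation_matrix_plane_rotation R S that transpose_def)
    qed
    ultimately have "c j * A $ i $ j = c i * A $ j $ i" "c j * A $ j $ i = c i * A $ i $ j"
      by (simp_all add: transpose_def)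
    \<comment> \<open>Eliminating \<open>A $ j $ i\<close> from the two symmetry relations gives
      \<open>(c i)\<^sup>2 * A $ i $ j = (c j)\<^sup>2 * A $ i $ j\<close>.\<close>
    then have "(c i + c j) * (c i - c j) * A $ i $ j = 0"
      by algebra
    moreover have "c i + c j \<noteq> 0"
      using c_pos[of i] c_pos[of j] by simp
    ultimately show ?thesis
      using c_inj[of i j] that by auto
  qed
  have "A = diag (\<chi> i. A $ i $ i)"
    using offdiag by (auto simp: diag_def vec_eq_iff)
  moreover have "F = transpose R ** A ** transpose S"
  proof -
    have "transpose R ** A ** transpose S = (transpose R ** R) ** F ** (S ** transpose S)"
      by (simp add: A_def matrix_mul_assoc)
    then show ?thesis
      by (simp add: rotation_matrix_inverse R S)
  qed
  ultimately show thesis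
    using that[of "transpose R" "transpose S"] R S by (metis rotation_matrix_transpose)
qed

section \<open>Hadamard products of rotations\<close>

lemma cofactor_mult_3: "cofactor (A ** B) = cofactor A ** cofactor B"
  for A B :: "real^3^3"
  by (simp add: vec_eq_iff forall_3 cofactor_3 matrix_matrix_mult_def sum_3 algebra_simps)

text \<open>The adjugate of a rotation is its inverse, hence its transpose. With
  \<open>cofactor_mult_3\<close>, the same pair of rotations therefore acts on \<open>F\<close> and
  on \<open>cofactor F\<close>.\<close>

lemma cofactor_rotation_matrix_3:
  fixes Q :: "real^3^3"
  assumes "rotation_matrix Q"
  shows "cofactor Q = Q"
proof -
  have "adjugate Q = adjugate Q ** Q ** transpose Q"
    using assms by (simp add: rotation_matrix_inverse flip: matrix_mul_assoc)
  also have "\<dots> = transpose Q"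
    using assms by (simp add: adjugate_mult_3 rotation_matrix_def)
  finally show ?thesis
    by (metis adjugate_def transpose_transpose)
qed

text \<open>The trace is \<open>1 + 2 * cos \<phi>\<close> for the rotation angle
  \<open>\<phi>\<close>. To avoid the rotation axis, the squared antisymmetric part is expressed as
  \<open>(3 - t) * (1 + t)\<close>, and unit rows give \<open>t \<le> 3\<close>.\<close>

lemma trace_rotation_matrix_3_ge:
  fixes Q :: "real^3^3"
  assumes "rotation_matrix Q"
  shows "-1 \<le> Q $ 1 $ 1 + Q $ 2 $ 2 + Q $ 3 $ 3"
proof -
  define t where "t = Q $ 1 $ 1 + Q $ 2 $ 2 + Q $ 3 $ 3"
  have cof: "cofactor Q = Q"
    using assms by (rule cofactor_rotation_matrix_3)
  have c: "Q$1$1 = Q$2$2 * Q$3$3 - Q$2$3 * Q$3$2" "Q$2$2 = Q$1$1 * Q$3$3 - Q$1$3 * Q$3$1"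
    "Q$3$3 = Q$1$1 * Q$2$2 - Q$1$2 * Q$2$1"
    by (subst cof[symmetric], simp add: cofactor_3)+
  have "Q ** transpose Q = mat 1"
    using assms by (simp add: rotation_matrix_inverse)
  then have rows: "(Q$1$1)\<^sup>2 + (Q$1$2)\<^sup>2 + (Q$1$3)\<^sup>2 = 1" "(Q$2$1)\<^sup>2 + (Q$2$2)\<^sup>2 + (Q$2$3)\<^sup>2 = 1"
    "(Q$3$1)\<^sup>2 + (Q$3$2)\<^sup>2 + (Q$3$3)\<^sup>2 = 1"
    by (simp_all add: vec_eq_iff forall_3 matrix_matrix_mult_def sum_3 transpose_def mat_def power2_eq_square)
  \<comment> \<open>For a rotation by the angle \<open>\<phi>\<close> both sides are \<open>(2 * sin \<phi>)\<^sup>2\<close>.\<close>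
  have "(Q$3$2 - Q$2$3)\<^sup>2 + (Q$1$3 - Q$3$1)\<^sup>2 + (Q$2$1 - Q$1$2)\<^sup>2 = (3 - t) * (1 + t)"
    using c rows unfolding t_def by algebra
  then have "0 \<le> (3 - t) * (1 + t)"
    by (metis add_nonneg_nonneg zero_le_power2)
  moreover have "(Q$1$1)\<^sup>2 \<le> 1\<^sup>2" "(Q$2$2)\<^sup>2 \<le> 1\<^sup>2" "(Q$3$3)\<^sup>2 \<le> 1\<^sup>2"
    using rows by (simp_all, smt (verit) zero_le_power2)+
  then have "t \<le> 3"
    using power2_le_imp_le[of "Q$1$1" 1] power2_le_imp_le[of "Q$2$2" 1] power2_le_imp_le[of "Q$3$3" 1]
    by (simp add: t_def)
  \<comment> \<open>At \<open>t = 3\<close> the product vanishes and says nothing about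
    \<open>1 + t\<close>, but there the bound is immediate.\<close>
  ultimately have "-1 \<le> t"
    by (cases "t = 3") (auto simp: zero_le_mult_iff)
  then show ?thesis
    by (simp add: t_def)
qed

section \<open>The tetrahedral group\<close>

definition diag_part :: "real^'n^'n \<Rightarrow> real^'n" where
  "diag_part A = (\<chi> i. A $ i $ i)"

text \<open>
  \<open>tet\<close> lists the vertices of a regular tetrahedron, namely the sign vectors with product 1.
  The matrix \<open>tet_mat p\<close> is the transpose of the isometry permuting them by \<open>p\<close>; these 24 matrices are
  the permutations of coordinates combined with an even number of sign changes.
\<close>

definition tet :: "4 \<Rightarrow> real^3" where
  "tet k = (if k = 1 then vector [1, 1, 1] else if k = 2 then vector [1, -1, -1]
     else if k = 3 then vector [-1, 1, -1] else vector [-1, -1, 1])"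

lemma tet_simps:
  "tet 1 = vector [1, 1, 1]" "tet 2 = vector [1, -1, -1]"
  "tet 3 = vector [-1, 1, -1]" "tet 4 = vector [-1, -1, 1]"
  by (simp_all add: tet_def)

definition tet_mat :: "(4 \<Rightarrow> 4) \<Rightarrow> real^3^3" where
  "tet_mat p = (\<chi> i j. (\<Sum>k\<in>UNIV. tet k $ i * tet (p k) $ j) / 4)"

lemma sum_tet: "(\<Sum>k\<in>UNIV. tet k $ j) = 0"
  using exhaust_3[of j] by (auto simp: sum_4 tet_simps)

text \<open>The Gram matrix of the vertices is four times the identity minus the all-ones matrix;
  the constant part vanishes against \<open>sum_tet\<close>.\<close>

lemma inner_tet: "(\<Sum>m\<in>UNIV. tet k $ m * tet l $ m) = (if k = l then 4 else 0) - 1"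
  using exhaust_4[of k] exhaust_4[of l] by (elim disjE) (simp_all add: sum_3 tet_simps)

lemma tet_mat_id: "tet_mat id = mat 1"
  by (simp add: tet_mat_def vec_eq_iff forall_3 sum_4 tet_simps mat_def)

text \<open>The order reverses because \<open>tet_mat p\<close> sends vertex \<open>p k\<close> back
  to vertex \<open>k\<close>.\<close>

lemma tet_mat_comp:
  assumes "q permutes UNIV"
  shows "tet_mat (q \<circ> p) = tet_mat p ** tet_mat q"
proof -
  have q: "(\<Sum>l\<in>UNIV. tet (q l) $ j) = 0" for j
    using sum.permute[OF assms, of "\<lambda>l. tet l $ j"] by (simp add: comp_def sum_tet)
  have "(tet_mat p ** tet_mat q) $ i $ j = tet_mat (q \<circ> p) $ i $ j" for i j
  proof -
    have "(tet_mat p ** tet_mat q) $ i $ j =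
        (\<Sum>m\<in>UNIV. \<Sum>k\<in>UNIV. \<Sum>l\<in>UNIV. tet k $ i * (tet (p k) $ m * tet l $ m) * tet (q l) $ j) / 16"
      by (simp add: tet_mat_def matrix_matrix_mult_def sum_product mult.assoc flip: sum_divide_distrib)
    also have "\<dots> = (\<Sum>k\<in>UNIV. \<Sum>l\<in>UNIV. \<Sum>m\<in>UNIV. tet k $ i * (tet (p k) $ m * tet l $ m) * tet (q l) $ j) / 16"
      by (subst sum.swap, subst (2) sum.swap) simp
    also have "\<dots> = (\<Sum>k\<in>UNIV. \<Sum>l\<in>UNIV. tet k $ i * (\<Sum>m\<in>UNIV. tet (p k) $ m * tet l $ m) * tet (q l) $ j) / 16"
      by (simp add: sum_distrib_left sum_distrib_right)
    also have "\<dots> = (\<Sum>k\<in>UNIV. tet k $ i * (\<Sum>l\<in>UNIV. ((if p k = l then 4 else 0) - 1) * tet (q l) $ j)) / 16"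
      by (simp add: inner_tet sum_distrib_left mult.assoc)
    also have "\<dots> = (\<Sum>k\<in>UNIV. tet k $ i * (4 * tet (q (p k)) $ j)) / 16"
      by (simp add: left_diff_distrib sum_subtractf q if_distrib[of "\<lambda>x. x * _"] cong: if_cong)
    also have "\<dots> = tet_mat (q \<circ> p) $ i $ j"
      by (simp add: tet_mat_def sum_divide_distrib)
    finally show ?thesis .
  qed
  then show ?thesis
    by (simp add: vec_eq_iff)
qed

text \<open>A signed permutation matrix \<open>A\<close> with entrywise absolute value
  \<open>P\<close> satisfies \<open>diag (A *v x) = A ** diag x ** transpose P\<close>. For a
  transposition of vertices, \<open>P\<close> is symmetric and both determinants are -1, so negating
  both factors yields rotations.\<close>

lemma tet_mat_transposition:
  assumes "a \<noteq> b"
  shows "\<exists>R S. rotation_matrix R \<and> rotation_matrix S \<and>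
    (\<forall>x. diag (tet_mat (Transposition.transpose a b) *v x) = R ** diag x ** S)"
proof -
  let ?A = "tet_mat (Transposition.transpose a b)"
  let ?R = "- ?A" and ?S = "\<chi> i j. - \<bar>?A $ i $ j\<bar>"
  have "rotation_matrix ?R \<and> rotation_matrix ?S \<and> (\<forall>x. diag (?A *v x) = ?R ** diag x ** ?S)"
    using assms exhaust_4[of a] exhaust_4[of b]
    by (elim disjE)
      (simp_all add: tet_mat_def rotation_matrix_def orthogonal_matrix vec_eq_iff forall_3 sum_4 tet_simps
        Transposition.transpose_def det_3 matrix_matrix_mult_def matrix_vector_mult_def sum_3 transpose_def mat_def diag_def)
  then show ?thesis
    by blast
qed

text \<open>Transpositions generate all permutations, and \<open>tet_mat_comp\<close> nests their
  pairs of rotations. Hence \<open>W (diag x)\<close> is invariant under each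
  \<open>tet_mat p\<close> for isotropic \<open>W\<close>.\<close>

lemma tet_mat_rotations:
  assumes "p permutes UNIV"
  shows "\<exists>R S. rotation_matrix R \<and> rotation_matrix S \<and> (\<forall>x. diag (tet_mat p *v x) = R ** diag x ** S)"
  using assms finite_class.finite_UNIV
proof (induction rule: permutes_induct)
  case id
  show ?case
    by (intro exI[of _ "mat 1"]) (simp add: tet_mat_id[unfolded id_def] rotation_matrix_mat_1)
next
  case (swap a b p)
  obtain R S where RS: "rotation_matrix R" "rotation_matrix S" "\<And>x. diag (tet_mat p *v x) = R ** diag x ** S"
    using swap.IH by blast
  obtain R' S' where RS': "rotation_matrix R'" "rotation_matrix S'"
    "\<And>x. diag (tet_mat (Transposition.transpose a b) *v x) = R' ** diag x ** S'"
    using tet_mat_transposition[OF swap.hyps(3)] by blast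
  have "tet_mat (Transposition.transpose a b \<circ> p) = tet_mat p ** tet_mat (Transposition.transpose a b)"
    by (simp add: tet_mat_comp permutes_swap_id)
  then have "diag (tet_mat (Transposition.transpose a b \<circ> p) *v x) = (R ** R') ** diag x ** (S' ** S)" for x
    by (simp add: RS(3) RS'(3) matrix_mul_assoc flip: matrix_vector_mul_assoc)
  then show ?case
    using rotation_matrix_mult[OF RS(1) RS'(1)] rotation_matrix_mult[OF RS'(2) RS(2)] by blast
qed

lemma rotation_matrix_diag_tet: "rotation_matrix (diag (tet k))"
  using exhaust_4[of k]
  by (elim disjE) (simp_all add: rotation_matrix_def orthogonal_matrix vec_eq_iff forall_3 tet_simps
      det_3 matrix_matrix_mult_def sum_3 transpose_def mat_def diag_def)

lemma diag_part_diag_conjugate: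
  fixes R S :: "real^'n^'n"
  shows "diag_part (R ** diag x ** S) = (\<chi> i. \<Sum>j\<in>UNIV. R $ i $ j * S $ j $ i * x $ j)"
  by (simp add: diag_part_def vec_eq_iff matrix_matrix_mult_def diag_def if_distrib[of "\<lambda>x. _ * x"] mult_ac cong: if_cong)

text \<open>
  The Hadamard product \<open>M\<close> of \<open>R\<close> and \<open>transpose S\<close> is a convex combination of the matrices \<open>tet_mat p\<close>:
  in tetrahedral coordinates it becomes the \<open>4 \<times> 4\<close> matrix \<open>B\<close>, whose rows and columns sum to 1 and whose
  entries are \<open>(1 + trace Q) / 4\<close> for rotations \<open>Q\<close>, hence nonnegative.
\<close>

lemma diag_part_rotations_3:
  fixes R S :: "real^3^3"
  assumes R: "rotation_matrix R" and S: "rotation_matrix S"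
  obtains w where "\<And>p. 0 \<le> w p" "(\<Sum>p | p permutes UNIV. w p) = 1"
    "\<And>x. diag_part (R ** diag x ** S) = (\<Sum>p | p permutes UNIV. w p *\<^sub>R (tet_mat p *v x))"
proof -
  define M where "M i j = R $ i $ j * S $ j $ i" for i j
  define B where "B k l = (1 + (\<Sum>i\<in>UNIV. \<Sum>j\<in>UNIV. tet k $ i * M i j * tet l $ j)) / 4" for k l
  have B_nonneg: "0 \<le> B k l" for k l
  proof -
    have "rotation_matrix (diag (tet k) ** R ** diag (tet l) ** S)"
      by (intro rotation_matrix_mult rotation_matrix_diag_tet R S)
    from trace_rotation_matrix_3_ge[OF this] show ?thesis
      by (simp add: B_def M_def matrix_matrix_mult_def diag_def sum_3 algebra_simps)
  qed
  have B_rows: "(\<Sum>l\<in>UNIV. B k l) = 1" for k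
    by (simp add: B_def sum_4 tet_simps sum_3 field_simps)
  have B_cols: "(\<Sum>k\<in>UNIV. B k l) = 1" for l
    by (simp add: B_def sum_4 tet_simps sum_3 field_simps)
  obtain w where w: "\<And>p. 0 \<le> w p" "(\<Sum>p | p permutes UNIV. w p) = 1"
    "\<And>k l. B k l = (\<Sum>p | p permutes UNIV. if p k = l then w p else 0)"
    using birkhoff_von_neumann[of B 1] B_nonneg B_rows B_cols by auto
  have M: "M i j = (\<Sum>p | p permutes UNIV. w p * tet_mat p $ i $ j)" for i j
  proof -
    \<comment> \<open>This inverts \<open>B_def\<close>: the coordinate functions
      \<open>\<lambda>k. tet k $ i\<close> are orthogonal to each other and to constants, with
      squared length 4.\<close>
    have "M i j = (\<Sum>k\<in>UNIV. \<Sum>l\<in>UNIV. tet k $ i * B k l * tet l $ j) / 4"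
      using exhaust_3[of i] exhaust_3[of j]
      by (elim disjE) (simp_all add: B_def sum_4 tet_simps sum_3 field_simps)
    also have "\<dots> = (\<Sum>k\<in>UNIV. \<Sum>l\<in>UNIV. \<Sum>p | p permutes UNIV. if p k = l then tet k $ i * w p * tet l $ j else 0) / 4"
      by (simp add: w(3) sum_distrib_left sum_distrib_right if_distrib[of "\<lambda>x. x * _"] if_distrib[of "\<lambda>x. _ * x"] cong: if_cong)
    also have "\<dots> = (\<Sum>k\<in>UNIV. \<Sum>p | p permutes UNIV. \<Sum>l\<in>UNIV. if p k = l then tet k $ i * w p * tet l $ j else 0) / 4"
      by (subst (2) sum.swap) simp
    also have "\<dots> = (\<Sum>p | p permutes UNIV. \<Sum>k\<in>UNIV. tet k $ i * w p * tet (p k) $ j) / 4"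
      by (subst sum.swap) simp
    also have "\<dots> = (\<Sum>p | p permutes UNIV. w p * tet_mat p $ i $ j)"
      by (simp add: tet_mat_def sum_divide_distrib sum_distrib_left mult_ac)
    finally show ?thesis .
  qed
  have "diag_part (R ** diag x ** S) = (\<Sum>p | p permutes UNIV. w p *\<^sub>R (tet_mat p *v x))" for x
  proof -
    have "(\<Sum>j\<in>UNIV. M i j * x $ j) = (\<Sum>p | p permutes UNIV. w p * (\<Sum>j\<in>UNIV. tet_mat p $ i $ j * x $ j))" for i
      by (simp add: M sum_distrib_left sum_distrib_right mult.assoc) (rule sum.swap)
    then show ?thesis
      by (simp add: diag_part_diag_conjugate vec_eq_iff matrix_vector_mult_def flip: M_def)
  qed
  then show thesis
    using that w by blast
qed

section \<open>Polyconvexity\<close>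

lemma convex_ext_compose_linear:
  assumes "convex_ext G" "linear L"
  shows "convex_ext (\<lambda>x. G (L x))"
  using assms by (simp add: convex_ext_def linear_add linear_cmul)

lemma convex_ext_SUP_linear:
  fixes L :: "'i \<Rightarrow> 'a::real_vector \<Rightarrow> 'b::real_vector"
  assumes g: "convex_on UNIV g" and "I \<noteq> {}" and lin: "\<And>i. i \<in> I \<Longrightarrow> linear (L i)"
  shows "convex_ext (\<lambda>x. SUP i\<in>I. ereal (g (L i x)))"
  unfolding convex_ext_def
proof (intro conjI allI impI)
  obtain i where "i \<in> I"
    using \<open>I \<noteq> {}\<close> by blast
  then have "ereal (g (L i x)) \<le> (SUP i\<in>I. ereal (g (L i x)))" for x
    by (rule SUP_upper)
  then show "(SUP i\<in>I. ereal (g (L i x))) \<noteq> -\<infinity>" for x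
    by (metis MInfty_neq_ereal(1) ereal_infty_less_eq(2))
next
  fix x y and u v :: real
  assume uv: "0 < u \<and> 0 < v \<and> u + v = 1"
  show "(SUP i\<in>I. ereal (g (L i (u *\<^sub>R x + v *\<^sub>R y))))
      \<le> ereal u * (SUP i\<in>I. ereal (g (L i x))) + ereal v * (SUP i\<in>I. ereal (g (L i y)))"
  proof (rule SUP_least)
    fix i assume i: "i \<in> I"
    have "g (L i (u *\<^sub>R x + v *\<^sub>R y)) \<le> u * g (L i x) + v * g (L i y)"
      using g uv lin[OF i] by (simp add: convex_on_def linear_add linear_cmul)
    then have "ereal (g (L i (u *\<^sub>R x + v *\<^sub>R y))) \<le> ereal u * ereal (g (L i x)) + ereal v * ereal (g (L i y))"
      by simp
    also have "\<dots> \<le> ereal u * (SUP i\<in>I. ereal (g (L i x))) + ereal v * (SUP i\<in>I. ereal (g (L i y)))"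
      using uv i by (intro add_mono ereal_mult_left_mono SUP_upper) auto
    finally show "ereal (g (L i (u *\<^sub>R x + v *\<^sub>R y))) \<le> \<dots>" .
  qed
qed

lemma convex_ext_domain:
  assumes "convex_ext g"
  shows "convex {x. g x \<noteq> \<infinity>}"
  unfolding convex_alt
proof (intro ballI allI impI, elim conjE)
  fix x y and u :: real
  assume xy: "x \<in> {x. g x \<noteq> \<infinity>}" "y \<in> {x. g x \<noteq> \<infinity>}" and u: "0 \<le> u" "u \<le> 1"
  show "(1 - u) *\<^sub>R x + u *\<^sub>R y \<in> {x. g x \<noteq> \<infinity>}"
  proof (cases "u = 0 \<or> u = 1")
    case True
    then show ?thesis
      using xy by auto
  next
    case False
    then have "g ((1 - u) *\<^sub>R x + u *\<^sub>R y) \<le> ereal (1 - u) * g x + ereal u * g y"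
      using assms u by (simp add: convex_ext_def)
    moreover obtain a b where "g x = ereal a" "g y = ereal b"
      using assms xy by (cases "g x"; cases "g y") (auto simp: convex_ext_def)
    ultimately show ?thesis
      by auto
  qed
qed

lemma convex_ext_finite_imp_convex_on:
  assumes "convex_ext g" "\<And>x. g x \<noteq> \<infinity>"
  obtains h where "convex_on UNIV h" "\<And>x. g x = ereal (h x)"
proof -
  have "\<forall>x. \<exists>r. g x = ereal r"
    using assms unfolding convex_ext_def by (metis ereal_cases)
  then obtain h where h: "\<And>x. g x = ereal (h x)"
    by metis
  have "convex_on UNIV h"
    unfolding convex_on_def
  proof (intro conjI ballI allI impI)
    fix x y and u v :: real
    assume "0 \<le> u" "0 \<le> v" "u + v = 1"
    then show "h (u *\<^sub>R x + v *\<^sub>R y) \<le> u * h x + v * h y"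
      using assms(1) unfolding convex_ext_def h
      by (cases "u = 0 \<or> v = 0") (auto simp: less_le)
  qed simp
  then show thesis
    using that h by blast
qed

text \<open>Serves as Jensen's inequality for orbits, on which \<open>g\<close> is constant.\<close>

lemma convex_on_sublevel: "convex_on UNIV g \<Longrightarrow> convex {x. g x \<le> c}"
  by (auto simp: convex_on_def convex_def) (meson convex_bound_le order_trans)

section \<open>Action of rotations on minors\<close>

lemma linear_diag: "linear diag"
  by (auto intro!: linearI simp: diag_def vec_eq_iff)

lemma linear_diag_part_conjugate:
  fixes R S :: "real^'n^'n"
  shows "linear (\<lambda>F. diag_part (R ** F ** S))"
  by (auto intro!: linearI
      simp: diag_part_def vec_eq_iff matrix_matrix_mult_def sum.distrib sum_distrib_left algebra_simps)

lemma diag_part_diag [simp]: "diag_part (diag x) = x"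
  by (simp add: diag_part_def diag_def vec_eq_iff)

lemma minors2_diag: "minors2 (diag \<nu>) = (diag (fst (m2 \<nu>)), snd (m2 \<nu>))"
  by (simp add: minors2_def m2_def det_2 diag_def)

text \<open>In terms of principal minors of \<open>diag \<nu>\<close>, the behaviour of minors under
  rotations carries over to \<open>m3\<close>.\<close>

lemma m3_cofactor: "m3 \<nu> = (\<nu>, diag_part (cofactor (diag \<nu>)), det (diag \<nu>))"
  by (simp add: m3_def cofactor_3 diag_part_def vec_eq_iff forall_3 det_3 diag_def)

lemma cofactor_diag_3: "cofactor (diag \<nu>) = diag (fst (snd (m3 \<nu>)))"
  by (simp add: m3_def cofactor_3 vec_eq_iff forall_3 diag_def)

lemma minors3_diag: "minors3 (diag \<nu>) = (diag (fst (m3 \<nu>)), diag (fst (snd (m3 \<nu>))), snd (snd (m3 \<nu>)))"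
  by (simp add: minors3_def adjugate_def cofactor_diag_3) (simp add: m3_cofactor)

lemma minors3_rotations:
  assumes "rotation_matrix R" "rotation_matrix S"
  shows "minors3 (R ** F ** S) = (R ** F ** S, R ** cofactor F ** S, det F)"
  using assms
  by (simp add: minors3_def adjugate_def cofactor_mult_3 cofactor_rotation_matrix_3 det_mul rotation_matrix_def)

lemma isotropic_rotations:
  assumes "isotropic W" "rotation_matrix R" "rotation_matrix S"
  shows "W (R ** F ** S) = W F"
  using assms unfolding isotropic_def by metis

text \<open>One pair \<open>R\<close>, \<open>S\<close> serves all vectors, hence both
  \<open>\<nu>\<close> and its vector of pairwise products, because cofactors transform by the same
  pair; the determinant is preserved.\<close>

lemma m3_tet_mat:
  assumes "p permutes UNIV"
  shows "m3 (tet_mat p *v \<nu>) = (tet_mat p *v \<nu>, tet_mat p *v fst (snd (m3 \<nu>)), snd (snd (m3 \<nu>)))"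
proof -
  obtain R S where R: "rotation_matrix R" and S: "rotation_matrix S"
    and RS: "\<And>x. diag (tet_mat p *v x) = R ** diag x ** S"
    using tet_mat_rotations[OF assms] by blast
  have "cofactor (diag (tet_mat p *v \<nu>)) = R ** cofactor (diag \<nu>) ** S"
    by (simp add: RS cofactor_mult_3 cofactor_rotation_matrix_3 R S)
  also have "\<dots> = diag (tet_mat p *v fst (snd (m3 \<nu>)))"
    by (simp add: RS cofactor_diag_3)
  finally have "diag_part (cofactor (diag (tet_mat p *v \<nu>))) = tet_mat p *v fst (snd (m3 \<nu>))"
    by simp
  moreover have "det (diag (tet_mat p *v \<nu>)) = det (diag \<nu>)"
    using R S by (simp add: RS det_mul rotation_matrix_def)
  ultimately show ?thesis
    by (simp add: m3_cofactor[of "tet_mat p *v \<nu>"]) (simp add: m3_cofactor)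
qed

text \<open>The weights \<open>w\<close> do not depend on the vector, so by
  \<open>m3_tet_mat\<close> the argument of \<open>g\<close> is a convex combination of the points
  \<open>m3 (tet_mat p *v \<nu>)\<close>, at each of which \<open>g\<close> equals
  \<open>W (diag \<nu>)\<close>.\<close>

lemma diag_part_rotations_le_3:
  fixes R S :: "real^3^3"
  assumes g: "convex_on UNIV g" and W: "isotropic W" "\<And>\<nu>. W (diag \<nu>) = g (m3 \<nu>)"
    and RS: "rotation_matrix R" "rotation_matrix S"
  shows "g (diag_part (R ** diag \<nu> ** S), diag_part (R ** cofactor (diag \<nu>) ** S), det (diag \<nu>))
    \<le> W (diag \<nu>)"
proof -
  obtain w where w: "\<And>p. 0 \<le> w p" "(\<Sum>p | p permutes UNIV. w p) = 1"
    "\<And>x. diag_part (R ** diag x ** S) = (\<Sum>p | p permutes UNIV. w p *\<^sub>R (tet_mat p *v x))"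
    using diag_part_rotations_3[OF RS] by blast
  have "(\<Sum>p | p permutes UNIV. w p *\<^sub>R m3 (tet_mat p *v \<nu>)) \<in> {x. g x \<le> W (diag \<nu>)}"
  proof (rule convex_sum)
    fix p :: "4 \<Rightarrow> 4" assume "p \<in> {p. p permutes UNIV}"
    then obtain R S where "rotation_matrix R" "rotation_matrix S"
      "\<And>x. diag (tet_mat p *v x) = R ** diag x ** S"
      using tet_mat_rotations by blast
    then show "m3 (tet_mat p *v \<nu>) \<in> {x. g x \<le> W (diag \<nu>)}"
      by (simp add: W(1) isotropic_rotations flip: W(2))
  qed (use w convex_on_sublevel[OF g] in \<open>auto simp: finite_permutations\<close>)
  also have "(\<Sum>p | p permutes UNIV. w p *\<^sub>R m3 (tet_mat p *v \<nu>)) =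
      (\<Sum>p | p permutes UNIV. (w p *\<^sub>R (tet_mat p *v \<nu>), w p *\<^sub>R (tet_mat p *v fst (snd (m3 \<nu>))), w p *\<^sub>R snd (snd (m3 \<nu>))))"
    by (intro sum.cong) (auto simp: m3_tet_mat)
  also have "\<dots> = (diag_part (R ** diag \<nu> ** S), diag_part (R ** diag (fst (snd (m3 \<nu>))) ** S), snd (snd (m3 \<nu>)))"
    by (simp add: sum_prod w flip: sum_distrib_right)
  finally show ?thesis
    by (simp add: cofactor_diag_3) (simp add: m3_cofactor)
qed

lemma rotation_matrix_2:
  fixes R :: "real^2^2"
  assumes "rotation_matrix R"
  shows "R$2$1 = - R$1$2" "R$2$2 = R$1$1" "(R$1$1)\<^sup>2 + (R$1$2)\<^sup>2 = 1"
proof -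
  have "R ** transpose R = mat 1"
    using assms by (rule rotation_matrix_inverse)
  then have rows: "(R$1$1)\<^sup>2 + (R$1$2)\<^sup>2 = 1" "(R$2$1)\<^sup>2 + (R$2$2)\<^sup>2 = 1"
    by (simp_all add: vec_eq_iff forall_2 matrix_matrix_mult_def sum_2 transpose_def mat_def power2_eq_square)
  moreover have "R$1$1 * R$2$2 - R$1$2 * R$2$1 = 1"
    using assms by (simp add: rotation_matrix_def det_2)
  \<comment> \<open>The left side is the sum of the squared row lengths minus twice the
    determinant.\<close>
  ultimately have "(R$2$2 - R$1$1)\<^sup>2 + (R$2$1 + R$1$2)\<^sup>2 = 0"
    by algebra
  then show "R$2$1 = - R$1$2" "R$2$2 = R$1$1"
    by (simp_all add: sum_power2_eq_zero_iff)
  show "(R$1$1)\<^sup>2 + (R$1$2)\<^sup>2 = 1"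
    by (rule rows)
qed

text \<open>Here the Hadamard product has \<open>p\<close> on and \<open>q\<close> off the diagonal,
  and the orbit consists of \<open>\<nu>\<close>, its swap, and their negatives, all with the same
  product of entries.\<close>

lemma diag_part_rotations_le_2:
  fixes R S :: "real^2^2"
  assumes g: "convex_on UNIV g" and W: "isotropic W" "\<And>\<nu>. W (diag \<nu>) = g (m2 \<nu>)"
    and RS: "rotation_matrix R" "rotation_matrix S"
  shows "g (diag_part (R ** diag \<nu> ** S), det (diag \<nu>)) \<le> W (diag \<nu>)"
proof -
  define C where "C = {x. g x \<le> W (diag \<nu>)}"
  have "convex C"
    unfolding C_def by (rule convex_on_sublevel[OF g])
  \<comment> \<open>\<open>J\<close> is a quarter turn: the pair \<open>J\<close>,
    \<open>- J\<close> swaps the diagonal entries, and \<open>J\<close>, \<open>J\<close> also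
    negates them.\<close>
  define J :: "real^2^2" where "J = vector [vector [0, 1], vector [-1, 0]]"
  have J: "rotation_matrix J" "rotation_matrix (- J)" "rotation_matrix (- mat 1 :: real^2^2)"
    by (simp_all add: J_def rotation_matrix_def orthogonal_matrix vec_eq_iff forall_2 matrix_matrix_mult_def sum_2
      transpose_def mat_def det_2)
  have orbit: "m2 \<mu> \<in> C" if "diag \<mu> = Q ** diag \<nu> ** Q'" "rotation_matrix Q" "rotation_matrix Q'" for \<mu> Q Q'
    using that by (simp add: C_def W(1) isotropic_rotations flip: W(2))
  have "m2 \<nu> \<in> C"
    by (rule orbit[of _ "mat 1" "mat 1"]) (simp_all add: rotation_matrix_mat_1)
  moreover have "m2 (- \<nu>) \<in> C"
    by (rule orbit[OF _ J(3) rotation_matrix_mat_1])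
      (simp add: vec_eq_iff forall_2 matrix_matrix_mult_def sum_2 mat_def diag_def)
  moreover have "m2 (vector [\<nu>$2, \<nu>$1]) \<in> C"
    by (rule orbit[OF _ J(1,2)])
      (simp add: J_def vec_eq_iff forall_2 matrix_matrix_mult_def sum_2 diag_def)
  moreover have "m2 (- vector [\<nu>$2, \<nu>$1]) \<in> C"
    by (rule orbit[OF _ J(1,1)])
      (simp add: J_def vec_eq_iff forall_2 matrix_matrix_mult_def sum_2 diag_def)
  moreover
  define p q where "p = R$1$1 * S$1$1" and "q = R$1$2 * S$2$1"
  note R = rotation_matrix_2[OF RS(1)] and S = rotation_matrix_2[OF RS(2)]
  \<comment> \<open>Product weights built from \<open>\<alpha>\<close> and \<open>\<beta>\<close>
    give net coefficients \<open>\<alpha> + \<beta> - 1 = p\<close> for \<open>\<nu>\<close> and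
    \<open>\<alpha> - \<beta> = q\<close> for its swap.\<close>
  define \<alpha> \<beta> where "\<alpha> = (1 + p + q) / 2" and "\<beta> = (1 + p - q) / 2"
  have ab: "0 \<le> \<alpha>" "\<alpha> \<le> 1" "0 \<le> \<beta>" "\<beta> \<le> 1"
  proof -
    \<comment> \<open>Up to sign conventions, \<open>p + q\<close> and \<open>p - q\<close> are the
      cosines of the sum and difference of the two rotation angles; the other squares are those of
      the sines.\<close>
    have "(p + q)\<^sup>2 + (R$1$1 * S$1$2 + R$1$2 * S$1$1)\<^sup>2 = 1" "(p - q)\<^sup>2 + (R$1$1 * S$1$2 - R$1$2 * S$1$1)\<^sup>2 = 1"
      using R(3) S(3) unfolding p_def q_def S(1) by algebra+
    then have "(p + q)\<^sup>2 \<le> 1" "(p - q)\<^sup>2 \<le> 1"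
      by (metis le_add_same_cancel1 zero_le_power2)+
    then have "\<bar>p + q\<bar> \<le> 1" "\<bar>p - q\<bar> \<le> 1"
      by (simp_all add: abs_square_le_1)
    then show "0 \<le> \<alpha>" "\<alpha> \<le> 1" "0 \<le> \<beta>" "\<beta> \<le> 1"
      by (auto simp: \<alpha>_def \<beta>_def)
  qed
  ultimately have "(1 - \<alpha>) *\<^sub>R ((1 - \<beta>) *\<^sub>R m2 (- \<nu>) + \<beta> *\<^sub>R m2 (- vector [\<nu>$2, \<nu>$1])) +
      \<alpha> *\<^sub>R ((1 - \<beta>) *\<^sub>R m2 (vector [\<nu>$2, \<nu>$1]) + \<beta> *\<^sub>R m2 \<nu>) \<in> C"
    using \<open>convex C\<close> unfolding convex_alt by metis
  also have "(1 - \<alpha>) *\<^sub>R ((1 - \<beta>) *\<^sub>R m2 (- \<nu>) + \<beta> *\<^sub>R m2 (- vector [\<nu>$2, \<nu>$1])) +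
      \<alpha> *\<^sub>R ((1 - \<beta>) *\<^sub>R m2 (vector [\<nu>$2, \<nu>$1]) + \<beta> *\<^sub>R m2 \<nu>) = 
      (diag_part (R ** diag \<nu> ** S), det (diag \<nu>))"
    unfolding diag_part_diag_conjugate
    by (simp add: m2_def vec_eq_iff forall_2 sum_2 det_2 diag_def R S \<alpha>_def \<beta>_def p_def q_def field_simps)
  finally show ?thesis
    by (simp add: C_def)
qed

text \<open>The point is the mean of \<open>m2\<close> over the vectors with entries
  \<open>t\<close> or \<open>-t\<close>. The weights are a Walsh expansion on sign patterns, whose
  orthogonality gives the prescribed means; a large \<open>t\<close> makes its coefficients small
  enough for nonnegativity.\<close>

lemma convex_hull_m2: "p \<in> convex hull (range m2)"
proof -
  define x1 x2 z where "x1 = fst p $ 1" and "x2 = fst p $ 2" and "z = snd p"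
  define t where "t = 1 + \<bar>x1\<bar> + \<bar>x2\<bar> + \<bar>z\<bar>"
  have t: "t \<ge> 1"
    by (simp add: t_def)
  define a1 a2 c where "a1 = x1 / t" and "a2 = x2 / t" and "c = z / t\<^sup>2"
  have "\<bar>c\<bar> \<le> \<bar>z\<bar> / t"
    using t by (simp add: c_def power2_eq_square frac_le)
  moreover have "\<bar>a1\<bar> + \<bar>a2\<bar> + \<bar>z\<bar> / t \<le> 1"
    using t by (simp add: a1_def a2_def flip: add_divide_distrib) (simp add: t_def)
  ultimately have small: "\<bar>a1\<bar> + \<bar>a2\<bar> + \<bar>c\<bar> \<le> 1"
    by simp
  define E where "E = {-1, 1::real} \<times> {-1, 1::real}"
  define w where "w = (\<lambda>(e1, e2). (1 + a1 * e1 + a2 * e2 + c * (e1 * e2)) / 4)"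
  have "(\<Sum>e\<in>E. w e *\<^sub>R m2 (case e of (e1, e2) \<Rightarrow> vector [t * e1, t * e2])) \<in> convex hull (range m2)"
  proof (rule convex_sum)
    show "sum w E = 1"
      by (simp add: E_def w_def field_simps flip: sum.cartesian_product)
    show "0 \<le> w e" if "e \<in> E" for e
      using that small by (auto simp: E_def w_def)
  qed (auto simp: E_def intro: hull_inc)
  also have "(\<Sum>e\<in>E. w e *\<^sub>R m2 (case e of (e1, e2) \<Rightarrow> vector [t * e1, t * e2])) =
      (vector [t * a1, t * a2], t\<^sup>2 * c)"
    by (simp add: E_def w_def m2_def vec_eq_iff forall_2 field_simps power2_eq_square flip: sum.cartesian_product)
  also have "\<dots> = p"
    using t by (simp add: a1_def a2_def c_def prod_eq_iff vec_eq_iff forall_2 x1_def x2_def z_def)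
  finally show ?thesis .
qed

text \<open>The same construction with the seven nonconstant Walsh functions on three signs.\<close>

lemma convex_hull_m3: "p \<in> convex hull (range m3)"
proof -
  define x1 x2 x3 where "x1 = fst p $ 1" and "x2 = fst p $ 2" and "x3 = fst p $ 3"
  define y1 y2 y3 where "y1 = fst (snd p) $ 1" and "y2 = fst (snd p) $ 2" and "y3 = fst (snd p) $ 3"
  define z where "z = snd (snd p)"
  define t where "t = 1 + \<bar>x1\<bar> + \<bar>x2\<bar> + \<bar>x3\<bar> + \<bar>y1\<bar> + \<bar>y2\<bar> + \<bar>y3\<bar> + \<bar>z\<bar>"
  have t: "t \<ge> 1"
    by (simp add: t_def)
  define a1 a2 a3 where "a1 = x1 / t" and "a2 = x2 / t" and "a3 = x3 / t"
  define b1 b2 b3 where "b1 = y1 / t\<^sup>2" and "b2 = y2 / t\<^sup>2" and "b3 = y3 / t\<^sup>2"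
  define c where "c = z / t ^ 3"
  have "t \<le> t\<^sup>2" "t \<le> t ^ 3"
    using t by (simp_all add: self_le_power)
  then have "\<bar>b1\<bar> \<le> \<bar>y1\<bar> / t" "\<bar>b2\<bar> \<le> \<bar>y2\<bar> / t" "\<bar>b3\<bar> \<le> \<bar>y3\<bar> / t" "\<bar>c\<bar> \<le> \<bar>z\<bar> / t"
    using t by (simp_all add: b1_def b2_def b3_def c_def frac_le)
  moreover have "\<bar>a1\<bar> + \<bar>a2\<bar> + \<bar>a3\<bar> + \<bar>y1\<bar> / t + \<bar>y2\<bar> / t + \<bar>y3\<bar> / t + \<bar>z\<bar> / t \<le> 1"
    using t by (simp add: a1_def a2_def a3_def flip: add_divide_distrib) (simp add: t_def)
  ultimately have small: "\<bar>a1\<bar> + \<bar>a2\<bar> + \<bar>a3\<bar> + \<bar>b1\<bar> + \<bar>b2\<bar> + \<bar>b3\<bar> + \<bar>c\<bar> \<le> 1"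
    by simp
  \<comment> \<open>Stated for abstract terms, the estimate is linear and covers all eight sign
    patterns at once.\<close>
  have nonneg: "0 \<le> 1 + r1 + r2 + r3 + r4 + r5 + r6 + r7"
    if "\<bar>r1\<bar> \<le> s1" "\<bar>r2\<bar> \<le> s2" "\<bar>r3\<bar> \<le> s3" "\<bar>r4\<bar> \<le> s4" "\<bar>r5\<bar> \<le> s5" "\<bar>r6\<bar> \<le> s6" "\<bar>r7\<bar> \<le> s7"
      and "s1 + s2 + s3 + s4 + s5 + s6 + s7 \<le> 1" for r1 r2 r3 r4 r5 r6 r7 s1 s2 s3 s4 s5 s6 s7 :: real
    using that unfolding abs_le_iff by linarith
  define E where "E = {-1, 1::real} \<times> {-1, 1::real} \<times> {-1, 1::real}"
  define w where "w = (\<lambda>(e1, e2, e3). (1 + a1 * e1 + a2 * e2 + a3 * e3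
    + b1 * (e2 * e3) + b2 * (e1 * e3) + b3 * (e1 * e2) + c * (e1 * e2 * e3)) / 8)"
  have "(\<Sum>e\<in>E. w e *\<^sub>R m3 (case e of (e1, e2, e3) \<Rightarrow> vector [t * e1, t * e2, t * e3])) \<in> convex hull (range m3)"
  proof (rule convex_sum)
    show "sum w E = 1"
      by (simp add: E_def w_def field_simps flip: sum.cartesian_product)
    show "0 \<le> w e" if E: "e \<in> E" for e
    proof -
      obtain e1 e2 e3 where e: "e = (e1, e2, e3)" "\<bar>e1\<bar> = 1" "\<bar>e2\<bar> = 1" "\<bar>e3\<bar> = 1"
        using E by (auto simp: E_def)
      have "0 \<le> 1 + a1 * e1 + a2 * e2 + a3 * e3
          + b1 * (e2 * e3) + b2 * (e1 * e3) + b3 * (e1 * e2) + c * (e1 * e2 * e3)"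
        by (rule nonneg[OF _ _ _ _ _ _ _ small]) (simp_all add: abs_mult e)
      then show ?thesis
        by (simp add: w_def e(1))
    qed
  qed (auto simp: E_def intro: hull_inc)
  also have "(\<Sum>e\<in>E. w e *\<^sub>R m3 (case e of (e1, e2, e3) \<Rightarrow> vector [t * e1, t * e2, t * e3])) =
      (vector [t * a1, t * a2, t * a3], vector [t\<^sup>2 * b1, t\<^sup>2 * b2, t\<^sup>2 * b3], t ^ 3 * c)"
    by (simp add: E_def w_def m3_def vec_eq_iff forall_3 field_simps power2_eq_square power3_eq_cube flip: sum.cartesian_product)
  also have "\<dots> = p"
    using t by (simp add: a1_def a2_def a3_def b1_def b2_def b3_def c_def prod_eq_iff vec_eq_iff forall_3
        x1_def x2_def x3_def y1_def y2_def y3_def z_def)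
  finally show ?thesis .
qed

lemma convex_ext_finite_on_hull:
  assumes "convex_ext g" "\<And>x. g (m x) \<noteq> \<infinity>" "\<And>p. p \<in> convex hull (range m)"
  shows "g p \<noteq> \<infinity>"
proof -
  have "convex hull (range m) \<subseteq> {x. g x \<noteq> \<infinity>}"
    using assms by (intro hull_minimal convex_ext_domain) auto
  then show ?thesis
    using assms(3) by blast
qed

section \<open>Equivalence of the notions of polyconvexity\<close>

lemma convex_on_imp_convex_ext: "convex_on UNIV g \<Longrightarrow> convex_ext (\<lambda>x. ereal (g x))"
  by (simp add: convex_ext_def convex_on_def)

lemma polyconvex_vec2_iff:
  "polyconvex_vec2 (\<lambda>\<nu>. ereal (\<Phi> \<nu>)) \<longleftrightarrow> (\<exists>g. convex_on UNIV g \<and> (\<forall>\<nu>. \<Phi> \<nu> = g (m2 \<nu>)))"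
proof
  assume "polyconvex_vec2 (\<lambda>\<nu>. ereal (\<Phi> \<nu>))"
  then obtain g where g: "convex_ext g" "\<And>\<nu>. ereal (\<Phi> \<nu>) = g (m2 \<nu>)"
    by (auto simp: polyconvex_vec2_def)
  have "g (m2 \<nu>) \<noteq> \<infinity>" for \<nu>
    unfolding g(2)[symmetric] by simp
  then have "g p \<noteq> \<infinity>" for p
    by (rule convex_ext_finite_on_hull[OF g(1) _ convex_hull_m2])
  then obtain h where "convex_on UNIV h" "\<And>x. g x = ereal (h x)"
    using convex_ext_finite_imp_convex_on g(1) by blast
  then show "\<exists>g. convex_on UNIV g \<and> (\<forall>\<nu>. \<Phi> \<nu> = g (m2 \<nu>))"
    using g(2) by auto
qed (auto simp: polyconvex_vec2_def intro: convex_on_imp_convex_ext)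

lemma polyconvex_vec3_iff:
  "polyconvex_vec3 (\<lambda>\<nu>. ereal (\<Phi> \<nu>)) \<longleftrightarrow> (\<exists>g. convex_on UNIV g \<and> (\<forall>\<nu>. \<Phi> \<nu> = g (m3 \<nu>)))"
proof
  assume "polyconvex_vec3 (\<lambda>\<nu>. ereal (\<Phi> \<nu>))"
  then obtain g where g: "convex_ext g" "\<And>\<nu>. ereal (\<Phi> \<nu>) = g (m3 \<nu>)"
    by (auto simp: polyconvex_vec3_def)
  have "g (m3 \<nu>) \<noteq> \<infinity>" for \<nu>
    unfolding g(2)[symmetric] by simp
  then have "g p \<noteq> \<infinity>" for p
    by (rule convex_ext_finite_on_hull[OF g(1) _ convex_hull_m3])
  then obtain h where "convex_on UNIV h" "\<And>x. g x = ereal (h x)"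
    using convex_ext_finite_imp_convex_on g(1) by blast
  then show "\<exists>g. convex_on UNIV g \<and> (\<forall>\<nu>. \<Phi> \<nu> = g (m3 \<nu>))"
    using g(2) by auto
qed (auto simp: polyconvex_vec3_def intro: convex_on_imp_convex_ext)

text \<open>The minors of \<open>diag \<nu>\<close> are a linear image of
  \<open>m2 \<nu>\<close>.\<close>

lemma polyconvex_mat2_imp_vec2:
  assumes "polyconvex_mat2 W"
  shows "polyconvex_vec2 (\<lambda>\<nu>. W (diag \<nu>))"
proof -
  obtain G where G: "convex_ext G" "\<And>F. W F = G (minors2 F)"
    using assms by (auto simp: polyconvex_mat2_def)
  have "linear (\<lambda>p :: (real^2) \<times> real. (diag (fst p), snd p))"
    by (auto intro!: linearI simp: linear_add[OF linear_diag] linear_cmul[OF linear_diag])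
  from convex_ext_compose_linear[OF G(1) this] show ?thesis
    unfolding polyconvex_vec2_def by (intro exI conjI) (auto simp: G(2) minors2_diag)
qed

lemma polyconvex_mat3_imp_vec3:
  assumes "polyconvex_mat3 W"
  shows "polyconvex_vec3 (\<lambda>\<nu>. W (diag \<nu>))"
proof -
  obtain G where G: "convex_ext G" "\<And>F. W F = G (minors3 F)"
    using assms by (auto simp: polyconvex_mat3_def)
  have "linear (\<lambda>p :: (real^3) \<times> (real^3) \<times> real. (diag (fst p), diag (fst (snd p)), snd (snd p)))"
    by (auto intro!: linearI simp: linear_add[OF linear_diag] linear_cmul[OF linear_diag])
  from convex_ext_compose_linear[OF G(1) this] show ?thesis
    unfolding polyconvex_vec3_def by (intro exI conjI) (auto simp: G(2) minors3_diag)
qed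

lemma polyconvex_mat2I:
  assumes g: "convex_on UNIV g" and W: "isotropic W" "\<And>\<nu>. W (diag \<nu>) = g (m2 \<nu>)"
  shows "polyconvex_mat2 (\<lambda>F. ereal (W F))"
proof -
  define SO2 where "SO2 = {R :: real^2^2. rotation_matrix R}"
  define L where "L RS p = (diag_part (fst RS ** fst p ** snd RS), snd p)"
    for RS :: "(real^2^2) \<times> (real^2^2)" and p :: "(real^2^2) \<times> real"
  define G where "G p = (SUP RS\<in>SO2 \<times> SO2. ereal (g (L RS p)))" for p
  have "linear (L RS)" for RS
    unfolding L_def
    by (auto intro!: linearI simp: linear_add[OF linear_diag_part_conjugate] linear_cmul[OF linear_diag_part_conjugate])
  then have "convex_ext G"
    unfolding G_def using rotation_matrix_mat_1
    by (intro convex_ext_SUP_linear[OF g]) (auto simp: SO2_def)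
  moreover have "ereal (W F) = G (minors2 F)" for F
  proof -
    obtain R S \<nu> where R: "rotation_matrix R" and S: "rotation_matrix S" and F: "F = R ** diag \<nu> ** S"
      by (rule signed_singular_value_decomposition)
    have det: "det F = det (diag \<nu>)"
      using R S by (simp add: F det_mul rotation_matrix_def)
    have WF: "W F = W (diag \<nu>)"
      by (simp add: F W(1) R S isotropic_rotations)
    \<comment> \<open>The singular value rotations are absorbed into the pair, which reduces both
      bounds to diagonal matrices.\<close>
    have L: "L (R', S') (minors2 F) = (diag_part ((R' ** R) ** diag \<nu> ** (S ** S')), det (diag \<nu>))" for R' S'
      by (simp add: L_def minors2_def det) (simp add: F matrix_mul_assoc)
    show ?thesis
      unfolding G_def
    proof (rule antisym)
      have "W F = g (m2 \<nu>)"
        by (simp add: WF W(2))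
      \<comment> \<open>The inverse rotations recover the diagonal form, so the supremum attains at
        least \<open>W F\<close>.\<close>
      also have "m2 \<nu> = L (transpose R, transpose S) (minors2 F)"
        by (simp add: L rotation_matrix_inverse R S) (simp add: m2_def det_2 diag_def)
      finally show "ereal (W F) \<le> (SUP RS\<in>SO2 \<times> SO2. ereal (g (L RS (minors2 F))))"
        using R S by (auto simp: SO2_def intro!: SUP_upper2[of "(transpose R, transpose S)"] rotation_matrix_transpose)
      show "(SUP RS\<in>SO2 \<times> SO2. ereal (g (L RS (minors2 F)))) \<le> ereal (W F)"
        using R S by (auto simp: SO2_def L WF intro!: SUP_least diag_part_rotations_le_2[OF g W] rotation_matrix_mult)
    qed
  qed
  ultimately show ?thesis
    unfolding polyconvex_mat2_def by blast
qed

lemma polyconvex_mat3I: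
  assumes g: "convex_on UNIV g" and W: "isotropic W" "\<And>\<nu>. W (diag \<nu>) = g (m3 \<nu>)"
  shows "polyconvex_mat3 (\<lambda>F. ereal (W F))"
proof -
  define SO3 where "SO3 = {R :: real^3^3. rotation_matrix R}"
  define L where "L RS p =
      (diag_part (fst RS ** fst p ** snd RS), diag_part (fst RS ** fst (snd p) ** snd RS), snd (snd p))"
    for RS :: "(real^3^3) \<times> (real^3^3)" and p :: "(real^3^3) \<times> (real^3^3) \<times> real"
  define G where "G p = (SUP RS\<in>SO3 \<times> SO3. ereal (g (L RS p)))" for p
  have "linear (L RS)" for RS
    unfolding L_def
    by (auto intro!: linearI simp: linear_add[OF linear_diag_part_conjugate] linear_cmul[OF linear_diag_part_conjugate])
  then have "convex_ext G"
    unfolding G_def using rotation_matrix_mat_1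
    by (intro convex_ext_SUP_linear[OF g]) (auto simp: SO3_def)
  moreover have "ereal (W F) = G (minors3 F)" for F
  proof -
    obtain R S \<nu> where R: "rotation_matrix R" and S: "rotation_matrix S" and F: "F = R ** diag \<nu> ** S"
      by (rule signed_singular_value_decomposition)
    have WF: "W F = W (diag \<nu>)"
      by (simp add: F W(1) R S isotropic_rotations)
    have L: "L (R', S') (minors3 F) = (diag_part ((R' ** R) ** diag \<nu> ** (S ** S')),
        diag_part ((R' ** R) ** cofactor (diag \<nu>) ** (S ** S')), det (diag \<nu>))" for R' S'
      by (simp add: L_def F minors3_rotations R S matrix_mul_assoc)
    show ?thesis
      unfolding G_def
    proof (rule antisym)
      have "W F = g (m3 \<nu>)"
        by (simp add: WF W(2))
      also have "m3 \<nu> = L (transpose R, transpose S) (minors3 F)"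
        by (simp add: L rotation_matrix_inverse R S m3_cofactor)
      finally show "ereal (W F) \<le> (SUP RS\<in>SO3 \<times> SO3. ereal (g (L RS (minors3 F))))"
        using R S by (auto simp: SO3_def intro!: SUP_upper2[of "(transpose R, transpose S)"] rotation_matrix_transpose)
      show "(SUP RS\<in>SO3 \<times> SO3. ereal (g (L RS (minors3 F)))) \<le> ereal (W F)"
        using R S by (auto simp: SO3_def L WF intro!: SUP_least diag_part_rotations_le_3[OF g W] rotation_matrix_mult)
    qed
  qed
  ultimately show ?thesis
    unfolding polyconvex_mat3_def by blast
qed

theorem corollary1p5:
  shows "(\<forall>(W :: real^2^2 \<Rightarrow> real) (\<Phi> :: real^2 \<Rightarrow> real).
            isotropic W \<and> (\<forall>\<nu>. \<Phi> \<nu> = W (diag \<nu>)) \<longrightarrow>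
              (polyconvex_mat2 (\<lambda>F. ereal (W F)) \<longleftrightarrow>
                 (\<exists>g :: (real^2) \<times> real \<Rightarrow> real.
                    convex_on UNIV g \<and> (\<forall>\<nu>. W (diag \<nu>) = g (m2 \<nu>)))) \<and>
              ((\<exists>g :: (real^2) \<times> real \<Rightarrow> real.
                    convex_on UNIV g \<and> (\<forall>\<nu>. W (diag \<nu>) = g (m2 \<nu>))) \<longleftrightarrow>
                 polyconvex_vec2 (\<lambda>\<nu>. ereal (\<Phi> \<nu>))))
       \<and> (\<forall>(W :: real^3^3 \<Rightarrow> real) (\<Phi> :: real^3 \<Rightarrow> real).
            isotropic W \<and> (\<forall>\<nu>. \<Phi> \<nu> = W (diag \<nu>)) \<longrightarrow>
              (polyconvex_mat3 (\<lambda>F. ereal (W F)) \<longleftrightarrow>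
                 (\<exists>g :: (real^3) \<times> (real^3) \<times> real \<Rightarrow> real.
                    convex_on UNIV g \<and> (\<forall>\<nu>. W (diag \<nu>) = g (m3 \<nu>)))) \<and>
              ((\<exists>g :: (real^3) \<times> (real^3) \<times> real \<Rightarrow> real.
                    convex_on UNIV g \<and> (\<forall>\<nu>. W (diag \<nu>) = g (m3 \<nu>))) \<longleftrightarrow>
                 polyconvex_vec3 (\<lambda>\<nu>. ereal (\<Phi> \<nu>))))"
proof (rule conjI; intro allI impI; elim conjE)
  fix W :: "real^2^2 \<Rightarrow> real" and \<Phi> :: "real^2 \<Rightarrow> real"
  assume "isotropic W" and \<Phi>: "\<forall>\<nu>. \<Phi> \<nu> = W (diag \<nu>)"
  \<comment> \<open>This is (ii) iff (iii). Restriction to diagonal matrices gives (i) to (iii), and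
    the lifted supremum gives (ii) to (i).\<close>
  moreover have "polyconvex_vec2 (\<lambda>\<nu>. ereal (\<Phi> \<nu>)) \<longleftrightarrow>
      (\<exists>g. convex_on UNIV g \<and> (\<forall>\<nu>. W (diag \<nu>) = g (m2 \<nu>)))"
    by (simp add: polyconvex_vec2_iff \<Phi>)
  ultimately show "(polyconvex_mat2 (\<lambda>F. ereal (W F)) \<longleftrightarrow>
      (\<exists>g. convex_on UNIV g \<and> (\<forall>\<nu>. W (diag \<nu>) = g (m2 \<nu>)))) \<and>
    ((\<exists>g. convex_on UNIV g \<and> (\<forall>\<nu>. W (diag \<nu>) = g (m2 \<nu>))) \<longleftrightarrow>
      polyconvex_vec2 (\<lambda>\<nu>. ereal (\<Phi> \<nu>)))"
    using polyconvex_mat2I polyconvex_mat2_imp_vec2[of "\<lambda>F. ereal (W F)"] by (auto simp: \<Phi>)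
next
  fix W :: "real^3^3 \<Rightarrow> real" and \<Phi> :: "real^3 \<Rightarrow> real"
  assume "isotropic W" and \<Phi>: "\<forall>\<nu>. \<Phi> \<nu> = W (diag \<nu>)"
  moreover have "polyconvex_vec3 (\<lambda>\<nu>. ereal (\<Phi> \<nu>)) \<longleftrightarrow>
      (\<exists>g. convex_on UNIV g \<and> (\<forall>\<nu>. W (diag \<nu>) = g (m3 \<nu>)))"
    by (simp add: polyconvex_vec3_iff \<Phi>)
  ultimately show "(polyconvex_mat3 (\<lambda>F. ereal (W F)) \<longleftrightarrow>
      (\<exists>g. convex_on UNIV g \<and> (\<forall>\<nu>. W (diag \<nu>) = g (m3 \<nu>)))) \<and>
    ((\<exists>g. convex_on UNIV g \<and> (\<forall>\<nu>. W (diag \<nu>) = g (m3 \<nu>))) \<longleftrightarrow>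
      polyconvex_vec3 (\<lambda>\<nu>. ereal (\<Phi> \<nu>)))"
    using polyconvex_mat3I polyconvex_mat3_imp_vec3[of "\<lambda>F. ereal (W F)"] by (auto simp: \<Phi>)
qed

end
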